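(* Let $m\geq2$ and $d\geq1$ be integers. Then the standard locus $U^{(m,d)}_{st}$ is a union of affine locally closed subsets of $\mathbb{P}(R_d)$ with respect to the Zariski topology.
   Context: $\mathbb{K}$ is an algebraically closed field of characteristic $0$; $R=\mathbb{K}[x_1,\dots,x_m]$ with the standard grading; $Q=\mathbb{K}[X_1,\dots,X_m]$, with $X_i=\partial/\partial x_i$, acts on $R$ by differentiation. The standard locus of socle degree $d$ and codimension $m$ is $$U^{(m,d)}_{st}=\{[f]\in\mathbb{P}(R_d)\mid \lambda(f)\neq0\ \text{for all nonzero}\ \lambda\in Q_1\}.$$ *)

theory Defs
  imports
    "HOL-Analysis.Abstract_Topology"
    "HOL-Library.Poly_Mapping"
    "HOL-Computational_Algebra.Polynomial"
begin

section \<open>Multivariate polynomials\<close>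

text \<open>
  A monomial maps each variable to its exponent and a polynomial maps each monomial to its
  coefficient, so the commutative ring structure is the one of \<^theory>\<open>HOL-Library.Poly_Mapping\<close>.
\<close>

type_synonym 'v monom = "'v \<Rightarrow>\<^sub>0 nat"
type_synonym ('v, 'k) mpoly = "'v monom \<Rightarrow>\<^sub>0 'k"

abbreviation lookup :: "('a \<Rightarrow>\<^sub>0 'b::zero) \<Rightarrow> 'a \<Rightarrow> 'b"
  where "lookup \<equiv> Poly_Mapping.lookup"

abbreviation keys :: "('a \<Rightarrow>\<^sub>0 'b::zero) \<Rightarrow> 'a set"
  where "keys \<equiv> Poly_Mapping.keys"

abbreviation scale :: "'k \<Rightarrow> ('v, 'k::comm_ring_1) mpoly \<Rightarrow> ('v, 'k) mpoly"
  where "scale c \<equiv> Poly_Mapping.map ((*) c)"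

definition mdeg :: "'v monom \<Rightarrow> nat"
  where "mdeg \<alpha> = (\<Sum>i\<in>keys \<alpha>. lookup \<alpha> i)"

text \<open>The zero polynomial is a form of every degree.\<close>

definition monoms :: "'v set \<Rightarrow> nat \<Rightarrow> 'v monom set"
  where "monoms I e = {\<alpha>. keys \<alpha> \<subseteq> I \<and> mdeg \<alpha> = e}"

definition polys :: "'v set \<Rightarrow> ('v, 'k::comm_ring_1) mpoly set"
  where "polys I = {p. \<forall>\<alpha>\<in>keys p. keys \<alpha> \<subseteq> I}"

definition forms :: "'v set \<Rightarrow> nat \<Rightarrow> ('v, 'k::comm_ring_1) mpoly set"
  where "forms I e = {p. keys p \<subseteq> monoms I e}"

definition monom_eval :: "('v \<Rightarrow> 'k::comm_ring_1) \<Rightarrow> 'v monom \<Rightarrow> 'k"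
  where "monom_eval a \<alpha> = (\<Prod>i\<in>keys \<alpha>. a i ^ lookup \<alpha> i)"

definition eval_at :: "('v \<Rightarrow> 'k::comm_ring_1) \<Rightarrow> ('v, 'k) mpoly \<Rightarrow> 'k"
  where "eval_at a p = (\<Sum>\<alpha>\<in>keys p. lookup p \<alpha> * monom_eval a \<alpha>)"

section \<open>The action by differentiation\<close>

text \<open>The truncated difference only occurs for \<open>i \<notin> keys \<beta>\<close>, where the coefficient is \<open>0\<close>.\<close>

definition partial :: "'v \<Rightarrow> ('v, 'k::comm_ring_1) mpoly \<Rightarrow> ('v, 'k) mpoly"
  where "partial i f =
    (\<Sum>\<beta>\<in>keys f. Poly_Mapping.single (\<beta> - Poly_Mapping.single i 1) (of_nat (lookup \<beta> i) * lookup f \<beta>))"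

text \<open>The partial derivatives commute, so the order of composition is irrelevant.\<close>

definition monom_diff :: "'v::linorder monom \<Rightarrow> ('v, 'k::comm_ring_1) mpoly \<Rightarrow> ('v, 'k) mpoly"
  where "monom_diff \<alpha> f = fold (\<lambda>i. partial i ^^ lookup \<alpha> i) (sorted_list_of_set (keys \<alpha>)) f"

definition diff_act ::
    "('v::linorder, 'k::comm_ring_1) mpoly \<Rightarrow> ('v, 'k) mpoly \<Rightarrow> ('v, 'k) mpoly"
  where "diff_act q f = (\<Sum>\<alpha>\<in>keys q. scale (lookup q \<alpha>) (monom_diff \<alpha> f))"

section \<open>The projective space of forms\<close>

text \<open>Points are the classes \<open>[f]\<close> of nonzero forms modulo nonzero scalars.\<close>

definition pclass :: "('v, 'k::field) mpoly \<Rightarrow> ('v, 'k) mpoly set"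
  where "pclass f = {scale c f |c. c \<noteq> 0}"

definition proj_forms :: "nat \<Rightarrow> nat \<Rightarrow> (nat, 'k::field) mpoly set set"
  where "proj_forms m d = {pclass f |f. f \<in> forms {..<m} d \<and> f \<noteq> 0}"

definition standard_locus :: "nat \<Rightarrow> nat \<Rightarrow> (nat, 'k::field) mpoly set set"
  where "standard_locus m d =
    {pclass f |f. f \<in> forms {..<m} d \<and> f \<noteq> 0 \<and>
       (\<forall>q\<in>forms {..<m} 1. q \<noteq> 0 \<longrightarrow> diff_act q f \<noteq> 0)}"

text \<open>The homogeneous coordinates of \<open>[f]\<close> are the coefficients \<open>lookup f \<alpha>\<close>, with \<open>\<alpha>\<close> ranging
  over the monomials of degree \<open>d\<close>.  So the homogeneous coordinate ring has one variable for each
  such \<open>\<alpha>\<close>.\<close>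

definition proj_zeros ::
    "nat \<Rightarrow> nat \<Rightarrow> (nat monom, 'k::field) mpoly set \<Rightarrow> (nat, 'k) mpoly set set"
  where "proj_zeros m d S = {p \<in> proj_forms m d. \<forall>F\<in>S. \<forall>f\<in>p. eval_at (lookup f) F = 0}"

definition proj_zariski :: "nat \<Rightarrow> nat \<Rightarrow> (nat, 'k::field) mpoly set topology"
  where "proj_zariski m d = topology (\<lambda>U.
    \<exists>S \<subseteq> (\<Union>e. forms (monoms {..<m} d) e). U = proj_forms m d - proj_zeros m d S)"

text \<open>Regular functions on a subset \<open>W\<close> of projective space: locally quotients of forms of the
  same degree.\<close>

definition proj_regular ::
    "nat \<Rightarrow> nat \<Rightarrow> (nat, 'k::field) mpoly set set \<Rightarrow> ((nat, 'k) mpoly set \<Rightarrow> 'k) \<Rightarrow> bool"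
  where "proj_regular m d W \<phi> \<longleftrightarrow>
    (\<forall>p\<in>W. \<exists>U. openin (proj_zariski m d) U \<and> p \<in> U \<and>
      (\<exists>e. \<exists>F\<in>forms (monoms {..<m} d) e. \<exists>G\<in>forms (monoms {..<m} d) e.
        \<forall>q\<in>U \<inter> W. \<forall>f\<in>q. eval_at (lookup f) G \<noteq> 0 \<and>
          \<phi> q = eval_at (lookup f) F / eval_at (lookup f) G))"

section \<open>Affine space\<close>

definition affine_space :: "nat \<Rightarrow> (nat \<Rightarrow> 'k::field) set"
  where "affine_space n = {..<n} \<rightarrow>\<^sub>E UNIV"

definition affine_zeros :: "nat \<Rightarrow> (nat, 'k::field) mpoly set \<Rightarrow> (nat \<Rightarrow> 'k) set"
  where "affine_zeros n S = {a \<in> affine_space n. \<forall>F\<in>S. eval_at a F = 0}"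

definition affine_zariski :: "nat \<Rightarrow> (nat \<Rightarrow> 'k::field) topology"
  where "affine_zariski n = topology (\<lambda>U.
    \<exists>S \<subseteq> polys {..<n}. U = affine_space n - affine_zeros n S)"

definition affine_regular ::
    "nat \<Rightarrow> (nat \<Rightarrow> 'k::field) set \<Rightarrow> ((nat \<Rightarrow> 'k) \<Rightarrow> 'k) \<Rightarrow> bool"
  where "affine_regular n W \<phi> \<longleftrightarrow>
    (\<forall>a\<in>W. \<exists>U. openin (affine_zariski n) U \<and> a \<in> U \<and>
      (\<exists>F\<in>polys {..<n}. \<exists>G\<in>polys {..<n}.
        \<forall>b\<in>U \<inter> W. eval_at b G \<noteq> 0 \<and> \<phi> b = eval_at b F / eval_at b G))"

section \<open>Affine locally closed subsets\<close>

definition locally_closedin :: "'a topology \<Rightarrow> 'a set \<Rightarrow> bool"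
  where "locally_closedin T A \<longleftrightarrow> (\<exists>U C. openin T U \<and> closedin T C \<and> A = U \<inter> C)"

text \<open>Isomorphism of spaces with functions.  As \<open>h\<close> is a bijection, every function on
  the preimage of \<open>W\<close> has the form \<open>\<phi> \<circ> h\<close>, so the equivalence says that both \<open>h\<close> and its inverse
  pull regular functions back to regular functions.\<close>

definition regular_isomorphism ::
    "'a topology \<Rightarrow> ('a set \<Rightarrow> ('a \<Rightarrow> 'k) \<Rightarrow> bool) \<Rightarrow>
     'b topology \<Rightarrow> ('b set \<Rightarrow> ('b \<Rightarrow> 'k) \<Rightarrow> bool) \<Rightarrow> ('a \<Rightarrow> 'b) \<Rightarrow> bool"
  where "regular_isomorphism X regX Y regY h \<longleftrightarrow>
    homeomorphic_map X Y h \<and>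
    (\<forall>W \<phi>. openin Y W \<longrightarrow> (regY W \<phi> \<longleftrightarrow> regX {x \<in> topspace X. h x \<in> W} (\<phi> \<circ> h)))"

text \<open>Affine: isomorphic to a closed subset of some affine space.  Irreducibility is not required.\<close>

definition affine_locally_closed :: "nat \<Rightarrow> nat \<Rightarrow> (nat, 'k::field) mpoly set set \<Rightarrow> bool"
  where "affine_locally_closed m d X \<longleftrightarrow>
    locally_closedin (proj_zariski m d) X \<and>
    (\<exists>n Y h. closedin (affine_zariski n) Y \<and>
       regular_isomorphism
         (subtopology (proj_zariski m d) X) (proj_regular m d)
         (subtopology (affine_zariski n) Y) (affine_regular n) h)"

section \<open>The Zariski topologies are topologies\<close>

text \<open>Without these facts the constant \<^const>\<open>topology\<close> would be unspecified above.\<close>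

lemma monom_eval_eq:
  assumes "finite J" "keys \<alpha> \<subseteq> J"
  shows "monom_eval a \<alpha> = (\<Prod>i\<in>J. a i ^ lookup \<alpha> i)"
  unfolding monom_eval_def using assms
  by (intro prod.mono_neutral_left) (auto simp: in_keys_iff)

lemma monom_eval_add: "monom_eval a (\<alpha> + \<beta>) = monom_eval a \<alpha> * monom_eval a \<beta>"
  using keys_add[of \<alpha> \<beta>]
  by (simp add: monom_eval_eq[of "keys \<alpha> \<union> keys \<beta>"] lookup_add power_add prod.distrib)

lemma eval_at_eq:
  assumes "finite A" "keys p \<subseteq> A"
  shows "eval_at a p = (\<Sum>\<alpha>\<in>A. lookup p \<alpha> * monom_eval a \<alpha>)"
  unfolding eval_at_def using assms
  by (intro sum.mono_neutral_left) (auto simp: in_keys_iff)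

lemma eval_at_add: "eval_at a (p + q) = eval_at a p + eval_at a q"
  using keys_add[of p q]
  by (simp add: eval_at_eq[of "keys p \<union> keys q"] lookup_add distrib_right sum.distrib)

lemma eval_at_0 [simp]: "eval_at a 0 = 0"
  by (simp add: eval_at_def)

lemma eval_at_sum: "eval_at a (sum f A) = (\<Sum>x\<in>A. eval_at a (f x))"
  by (induction A rule: infinite_finite_induct) (auto simp: eval_at_add)

lemma eval_at_single [simp]: "eval_at a (Poly_Mapping.single \<alpha> c) = c * monom_eval a \<alpha>"
  by (cases "c = 0") (auto simp: eval_at_def)

lemma eval_at_1 [simp]: "eval_at a 1 = 1"
  by (simp add: monom_eval_def flip: single_one)

lemma poly_mapping_expand:
  "p = (\<Sum>\<alpha>\<in>keys p. Poly_Mapping.single \<alpha> (lookup p \<alpha>))"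
  by (rule poly_mapping_eqI)
     (auto simp: lookup_sum lookup_single when_def in_keys_iff sum.delta)

lemma eval_at_mult: "eval_at a (p * q) = eval_at a p * eval_at a q"
proof -
  have "p * q = (\<Sum>\<alpha>\<in>keys p. Poly_Mapping.single \<alpha> (lookup p \<alpha>)) *
      (\<Sum>\<beta>\<in>keys q. Poly_Mapping.single \<beta> (lookup q \<beta>))"
    using poly_mapping_expand[of p] poly_mapping_expand[of q] by (rule arg_cong2)
  also have "\<dots> = (\<Sum>\<alpha>\<in>keys p. \<Sum>\<beta>\<in>keys q.
      Poly_Mapping.single (\<alpha> + \<beta>) (lookup p \<alpha> * lookup q \<beta>))"
    by (simp add: sum_product mult_single)
  finally have "eval_at a (p * q) = (\<Sum>\<alpha>\<in>keys p. \<Sum>\<beta>\<in>keys q.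
      (lookup p \<alpha> * monom_eval a \<alpha>) * (lookup q \<beta> * monom_eval a \<beta>))"
    by (simp only: eval_at_sum eval_at_single monom_eval_add mult_ac)
  then show ?thesis
    by (simp only: eval_at_def sum_product)
qed

lemma mdeg_add: "mdeg (\<alpha> + \<beta>) = mdeg \<alpha> + mdeg \<beta>"
proof -
  have *: "mdeg \<gamma> = (\<Sum>i\<in>keys \<alpha> \<union> keys \<beta>. lookup \<gamma> i)" if "keys \<gamma> \<subseteq> keys \<alpha> \<union> keys \<beta>" for \<gamma>
    unfolding mdeg_def using that by (intro sum.mono_neutral_left) (auto simp: in_keys_iff)
  show ?thesis
    using keys_add[of \<alpha> \<beta>] by (simp add: * lookup_add sum.distrib)
qed

lemma forms_mult:
  assumes "p \<in> forms I e" "q \<in> forms I e'"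
  shows "p * q \<in> forms I (e + e')"
  unfolding forms_def
proof (intro CollectI subsetI)
  fix \<gamma> assume "\<gamma> \<in> keys (p * q)"
  then obtain \<alpha> \<beta> where "\<alpha> \<in> keys p" "\<beta> \<in> keys q" and \<gamma>: "\<gamma> = \<alpha> + \<beta>"
    using keys_mult[of p q] by blast
  then have "\<alpha> \<in> monoms I e" "\<beta> \<in> monoms I e'"
    using assms by (auto simp: forms_def)
  then show "\<gamma> \<in> monoms I (e + e')"
    unfolding \<gamma> using keys_add[of \<alpha> \<beta>] by (auto simp: monoms_def mdeg_add)
qed

lemma polys_mult:
  assumes "p \<in> polys I" "q \<in> polys I"
  shows "p * q \<in> polys I"
  unfolding polys_def
proof (intro CollectI ballI)
  fix \<gamma> assume "\<gamma> \<in> keys (p * q)"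
  then obtain \<alpha> \<beta> where "\<alpha> \<in> keys p" "\<beta> \<in> keys q" and \<gamma>: "\<gamma> = \<alpha> + \<beta>"
    using keys_mult[of p q] by blast
  then have "keys \<alpha> \<subseteq> I" "keys \<beta> \<subseteq> I"
    using assms by (auto simp: polys_def)
  then show "keys \<gamma> \<subseteq> I"
    unfolding \<gamma> using keys_add[of \<alpha> \<beta>] by blast
qed

lemma one_in_forms: "1 \<in> forms I 0"
  by (simp add: forms_def monoms_def mdeg_def)

lemma one_in_polys: "1 \<in> polys I"
  by (simp add: polys_def)

lemma istopology_zero_loci:
  assumes mult: "\<And>F G. F \<in> A \<Longrightarrow> G \<in> A \<Longrightarrow> F * G \<in> A"
    and v_mult: "\<And>x F G. x \<in> P \<Longrightarrow> F \<in> A \<Longrightarrow> G \<in> A \<Longrightarrow> v x (F * G) \<longleftrightarrow> v x F \<or> v x G"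
  shows "istopology (\<lambda>U. \<exists>S\<subseteq>A. U = P - {x \<in> P. \<forall>F\<in>S. v x F})"
  unfolding istopology_def
proof (intro conjI allI impI)
  fix U V
  assume "\<exists>S\<subseteq>A. U = P - {x \<in> P. \<forall>F\<in>S. v x F}" "\<exists>S\<subseteq>A. V = P - {x \<in> P. \<forall>F\<in>S. v x F}"
  then obtain S T where ST: "S \<subseteq> A" "U = P - {x \<in> P. \<forall>F\<in>S. v x F}"
      "T \<subseteq> A" "V = P - {x \<in> P. \<forall>F\<in>T. v x F}"
    by blast
  let ?R = "{F * G |F G. F \<in> S \<and> G \<in> T}"
  have *: "v x (F * G) \<longleftrightarrow> v x F \<or> v x G" if "x \<in> P" "F \<in> S" "G \<in> T" for x F G
    using v_mult that ST by blast
  have "U \<inter> V = P - {x \<in> P. \<forall>F\<in>?R. v x F}"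
    unfolding ST(2,4) using * by blast
  moreover have "?R \<subseteq> A" using ST mult by blast
  ultimately show "\<exists>S\<subseteq>A. U \<inter> V = P - {x \<in> P. \<forall>F\<in>S. v x F}" by blast
next
  fix \<K>
  assume "\<forall>K\<in>\<K>. \<exists>S\<subseteq>A. K = P - {x \<in> P. \<forall>F\<in>S. v x F}"
  then obtain s where s: "\<And>K. K \<in> \<K> \<Longrightarrow> s K \<subseteq> A \<and> K = P - {x \<in> P. \<forall>F\<in>s K. v x F}"
    by metis
  have "\<Union>\<K> = P - {x \<in> P. \<forall>F\<in>(\<Union>K\<in>\<K>. s K). v x F}"
    using s by fast
  moreover have "(\<Union>K\<in>\<K>. s K) \<subseteq> A" using s by blast
  ultimately show "\<exists>S\<subseteq>A. \<Union>\<K> = P - {x \<in> P. \<forall>F\<in>S. v x F}" by blast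
qed

lemma lookup_scale [simp]: "lookup (scale c f) \<alpha> = c * lookup f \<alpha>"
  by (simp add: Poly_Mapping.map.rep_eq when_def)

lemma monom_eval_scale: "monom_eval (\<lambda>i. c * a i) \<alpha> = c ^ mdeg \<alpha> * monom_eval a \<alpha>"
  by (simp add: monom_eval_def mdeg_def power_mult_distrib prod.distrib power_sum)

lemma eval_at_form_scale:
  assumes "F \<in> forms I e"
  shows "eval_at (lookup (scale c f)) F = c ^ e * eval_at (lookup f) F"
proof -
  have "eval_at (\<lambda>\<alpha>. c * lookup f \<alpha>) F = c ^ e * eval_at (lookup f) F"
    unfolding eval_at_def sum_distrib_left
    using assms by (intro sum.cong) (auto simp: monom_eval_scale forms_def monoms_def mult_ac)
  moreover have "lookup (scale c f) = (\<lambda>\<alpha>. c * lookup f \<alpha>)" by auto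
  ultimately show ?thesis by metis
qed

lemma pclass_self: "f \<in> pclass f"
proof -
  have "scale 1 f = f" by (rule poly_mapping_eqI) simp
  then show ?thesis unfolding pclass_def by (metis (mono_tags, lifting) mem_Collect_eq zero_neq_one)
qed

lemma eval_at_form_pclass:
  assumes "F \<in> forms I e"
  shows "(\<forall>g\<in>pclass f. eval_at (lookup g) F = 0) \<longleftrightarrow> eval_at (lookup f) F = 0"
proof
  assume "\<forall>g\<in>pclass f. eval_at (lookup g) F = 0"
  then show "eval_at (lookup f) F = 0" using pclass_self by blast
next
  assume "eval_at (lookup f) F = 0"
  then show "\<forall>g\<in>pclass f. eval_at (lookup g) F = 0"
    using eval_at_form_scale[OF assms] by (auto simp: pclass_def)
qed

lemma istopology_proj_zariski:
  "istopology (\<lambda>U. \<exists>S \<subseteq> (\<Union>e. forms (monoms {..<m} d) e).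
     U = proj_forms m d - proj_zeros m d (S :: (nat monom, 'k::field) mpoly set))"
  unfolding proj_zeros_def
proof (rule istopology_zero_loci)
  let ?A = "(\<Union>e. forms (monoms {..<m} d) e) :: (nat monom, 'k) mpoly set"
  fix F G :: "(nat monom, 'k) mpoly" assume "F \<in> ?A" "G \<in> ?A"
  then obtain e e' where F: "F \<in> forms (monoms {..<m} d) e"
    and G: "G \<in> forms (monoms {..<m} d) e'" by blast
  note FG = forms_mult[OF F G]
  show "F * G \<in> ?A" using FG by blast
  fix p :: "(nat, 'k) mpoly set" assume "p \<in> proj_forms m d"
  then obtain f where f: "p = pclass f" by (auto simp: proj_forms_def)
  show "(\<forall>f\<in>p. eval_at (lookup f) (F * G) = 0) \<longleftrightarrow>
      (\<forall>f\<in>p. eval_at (lookup f) F = 0) \<or> (\<forall>f\<in>p. eval_at (lookup f) G = 0)"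
    unfolding f eval_at_form_pclass[OF F] eval_at_form_pclass[OF G] eval_at_form_pclass[OF FG]
    by (simp add: eval_at_mult)
qed

lemma openin_proj_zariski:
  "openin (proj_zariski m d) U \<longleftrightarrow>
    (\<exists>S \<subseteq> (\<Union>e. forms (monoms {..<m} d) e). U = proj_forms m d - proj_zeros m d S)"
  unfolding proj_zariski_def by (simp add: topology_inverse'[OF istopology_proj_zariski])

lemma topspace_proj_zariski: "topspace (proj_zariski m d) = proj_forms m d"
proof (rule antisym)
  show "topspace (proj_zariski m d) \<subseteq> proj_forms m d"
    by (auto simp: topspace_def openin_proj_zariski)
  have "proj_zeros m d {1} = {}"
    using pclass_self by (fastforce simp: proj_zeros_def proj_forms_def)
  then have "openin (proj_zariski m d) (proj_forms m d)"
    unfolding openin_proj_zariski using one_in_forms by (intro exI[of _ "{1}"]) auto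
  then show "proj_forms m d \<subseteq> topspace (proj_zariski m d)"
    by (rule openin_subset)
qed

lemma closedin_proj_zariski:
  "closedin (proj_zariski m d) C \<longleftrightarrow>
    (\<exists>S \<subseteq> (\<Union>e. forms (monoms {..<m} d) e). C = proj_zeros m d S)"
proof -
  have "proj_zeros m d S \<subseteq> proj_forms m d" for S :: "(nat monom, 'a) mpoly set"
    by (auto simp: proj_zeros_def)
  then show ?thesis
    unfolding closedin_def topspace_proj_zariski openin_proj_zariski
    by (metis Diff_subset double_diff subset_refl)
qed

lemma istopology_affine_zariski:
  "istopology (\<lambda>U. \<exists>S \<subseteq> polys {..<n}.
     U = affine_space n - affine_zeros n (S :: (nat, 'k::field) mpoly set))"
  unfolding affine_zeros_def
  by (rule istopology_zero_loci) (auto simp: polys_mult eval_at_mult)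

lemma openin_affine_zariski:
  "openin (affine_zariski n) U \<longleftrightarrow>
    (\<exists>S \<subseteq> polys {..<n}. U = affine_space n - affine_zeros n S)"
  unfolding affine_zariski_def by (simp add: topology_inverse'[OF istopology_affine_zariski])

lemma topspace_affine_zariski: "topspace (affine_zariski n) = affine_space n"
proof (rule antisym)
  show "topspace (affine_zariski n) \<subseteq> affine_space n"
    by (auto simp: topspace_def openin_affine_zariski)
  have "openin (affine_zariski n) (affine_space n)"
    unfolding openin_affine_zariski using one_in_polys
    by (intro exI[of _ "{1}"]) (auto simp: affine_zeros_def)
  then show "affine_space n \<subseteq> topspace (affine_zariski n)"
    by (rule openin_subset)
qed

lemma closedin_affine_zariski:
  "closedin (affine_zariski n) C \<longleftrightarrow> (\<exists>S \<subseteq> polys {..<n}. C = affine_zeros n S)"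
proof -
  have "affine_zeros n S \<subseteq> affine_space n" for S :: "(nat, 'a) mpoly set"
    by (auto simp: affine_zeros_def)
  then show ?thesis
    unfolding closedin_def topspace_affine_zariski openin_affine_zariski
    by (metis Diff_subset double_diff subset_refl)
qed

end

theory Submission
  imports Defs
begin

text \<open>
  The standard condition on \<open>f\<close> says that the partial derivatives of \<open>f\<close> with respect to the
  \<open>m\<close> variables are linearly independent (\<open>standard_iff_gradient_independent\<close>).  Their coefficient
  rows have entries that are linear in the coefficients of \<open>f\<close>, and independence of finitely
  many rows is a non-vanishing condition on finitely many polynomials in the entries.  Maximal
  minors are one choice of such polynomials.  Here Gaussian elimination without division gives
  another: for a chosen list of pivot columns, one per row, it returns the product of the pivots, and the
  rows are independent iff some list of columns has a nonzero pivot product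
  (\<open>rows_independent_iff_pivot_product\<close>).  This avoids determinants; moreover each elimination
  step only multiplies and subtracts, so it commutes with evaluation and, applied to the
  generic rows, produces forms in the homogeneous coordinates.  The locus is therefore a finite
  union of sets \<open>F \<noteq> 0\<close> with \<open>F\<close> a form.

  Each of these sets is cut into the pieces on which also one homogeneous coordinate \<open>f\<^sub>\<alpha>\<close> is
  nonzero.  Some coordinate of every point is nonzero, so the pieces still cover.  On such a
  piece every class has a unique representative \<open>s\<close> with \<open>s\<^sub>\<alpha> = 1\<close>, and sending the class to the coefficients
  of \<open>s\<close> together with \<open>t = 1 / F(s)\<close> identifies the piece with the closed subset \<open>a\<^sub>\<alpha> = 1\<close>,
  \<open>t F(a) = 1\<close> of an affine space (\<open>affine_chart_piece\<close>).  Normalizing one coordinate in this way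
  replaces the Veronese embedding, the usual way to see that the whole set \<open>F \<noteq> 0\<close> is affine.

  That the identification is an isomorphism of spaces with functions comes down to two
  translations (\<open>affine_locally_closed_by_coordinates\<close>): polynomials in the affine coordinates
  become quotients of forms of equal degree, and the value of a form at the normalized representative
  is a polynomial in the affine coordinates.
\<close>

section \<open>Evaluation, homogeneous forms and projective classes\<close>

lemma eval_at_diff: "eval_at a (p - q) = eval_at a p - eval_at a q"
  using keys_diff[of p q]
  by (simp add: eval_at_eq[of "keys p \<union> keys q"] lookup_minus left_diff_distrib sum_subtractf)

lemma forms_diff:
  assumes "p \<in> forms I e" "q \<in> forms I e"
  shows "p - q \<in> forms I e"
  using assms keys_diff[of p q] by (auto simp: forms_def)

lemma forms_add:
  assumes "p \<in> forms I e" "q \<in> forms I e"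
  shows "p + q \<in> forms I e"
  using assms keys_add[of p q] by (auto simp: forms_def)

lemma polys_diff:
  assumes "p \<in> polys I" "q \<in> polys I"
  shows "p - q \<in> polys I"
  using assms keys_diff[of p q] by (auto simp: polys_def)

lemma mdeg_single [simp]: "mdeg (Poly_Mapping.single i k) = k"
  by (cases "k = 0") (auto simp: mdeg_def)

lemma monom_eval_single [simp]: "monom_eval a (Poly_Mapping.single i k) = a i ^ k"
  by (cases "k = 0") (auto simp: monom_eval_def)

lemma monom_eval_0 [simp]: "monom_eval a 0 = 1"
  by (simp add: monom_eval_def)

lemma monom_eval_sum: "monom_eval a (sum f A) = (\<Prod>x\<in>A. monom_eval a (f x))"
  by (induction A rule: infinite_finite_induct) (auto simp: monom_eval_add)

abbreviation coord :: "'v \<Rightarrow> ('v, 'k::comm_ring_1) mpoly"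
  where "coord i \<equiv> Poly_Mapping.single (Poly_Mapping.single i 1) 1"

lemma scaled_coord_in_forms: "i \<in> I \<Longrightarrow> Poly_Mapping.single (Poly_Mapping.single i 1) c \<in> forms I 1"
  by (auto simp: forms_def monoms_def)

lemma constant_in_forms: "Poly_Mapping.single 0 c \<in> forms I 0"
  by (auto simp: forms_def monoms_def mdeg_def)

lemma coord_in_polys: "i \<in> I \<Longrightarrow> coord i \<in> polys I"
  by (auto simp: polys_def)

lemma forms_subset_polys: "forms I e \<subseteq> polys I"
  by (auto simp: forms_def polys_def monoms_def)

lemma eval_at_cong:
  assumes "F \<in> polys I" "\<And>i. i \<in> I \<Longrightarrow> a i = b i"
  shows "eval_at a F = eval_at b F"
  unfolding eval_at_def monom_eval_def using assms
  by (intro sum.cong arg_cong2[where f="(*)"] prod.cong refl) (force simp: polys_def)+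

lemma rename_variables:
  assumes "F \<in> polys I"
  obtains P where "P \<in> polys (g ` I)" "\<And>a. eval_at a P = eval_at (a \<circ> g) F"
proof
  define r where "r \<mu> = (\<Sum>i\<in>keys \<mu>. Poly_Mapping.single (g i) (lookup \<mu> i))" for \<mu> :: "'a monom"
  define P where "P = (\<Sum>\<mu>\<in>keys F. Poly_Mapping.single (r \<mu>) (lookup F \<mu>))"
  have r: "keys (r \<mu>) \<subseteq> g ` I" if "\<mu> \<in> keys F" for \<mu>
  proof -
    have "keys (r \<mu>) \<subseteq> (\<Union>i\<in>keys \<mu>. keys (Poly_Mapping.single (g i) (lookup \<mu> i)))"
      unfolding r_def by (rule keys_sum)
    also have "\<dots> \<subseteq> g ` I" using assms that by (auto simp: polys_def split: if_splits)
    finally show ?thesis .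
  qed
  have "keys P \<subseteq> (\<Union>\<mu>\<in>keys F. keys (Poly_Mapping.single (r \<mu>) (lookup F \<mu>)))"
    unfolding P_def by (rule keys_sum)
  then have "keys P \<subseteq> r ` keys F" by (auto split: if_splits)
  then show "P \<in> polys (g ` I)" using r by (auto simp: polys_def)
  have "monom_eval a (r \<mu>) = monom_eval (a \<circ> g) \<mu>" for a :: "_ \<Rightarrow> 'b" and \<mu>
    unfolding r_def monom_eval_sum by (simp add: monom_eval_def[of "a \<circ> g"])
  then show "eval_at a P = eval_at (a \<circ> g) F" for a
    unfolding P_def eval_at_sum eval_at_single by (simp add: eval_at_def)
qed

lemma finite_monoms:
  assumes "finite I"
  shows "finite (monoms I e)"
proof -
  have "inj_on (\<lambda>\<alpha>. restrict (lookup \<alpha>) I) (monoms I e)"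
  proof (rule inj_onI)
    fix \<alpha> \<beta> assume *: "\<alpha> \<in> monoms I e" "\<beta> \<in> monoms I e"
      "restrict (lookup \<alpha>) I = restrict (lookup \<beta>) I"
    show "\<alpha> = \<beta>"
    proof (rule poly_mapping_eqI)
      fix i show "lookup \<alpha> i = lookup \<beta> i"
      proof (cases "i \<in> I")
        case True
        then show ?thesis using fun_cong[OF *(3), of i] by simp
      next
        case False
        then have "i \<notin> keys \<alpha>" "i \<notin> keys \<beta>" using * by (auto simp: monoms_def)
        then show ?thesis by (simp add: in_keys_iff)
      qed
    qed
  qed
  moreover have "(\<lambda>\<alpha>. restrict (lookup \<alpha>) I) ` monoms I e \<subseteq> I \<rightarrow>\<^sub>E {..e}"
  proof (rule image_subsetI)
    fix \<alpha> assume \<alpha>: "\<alpha> \<in> monoms I e"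
    have "lookup \<alpha> i \<le> e" for i
    proof (cases "i \<in> keys \<alpha>")
      case True
      then have "lookup \<alpha> i \<le> mdeg \<alpha>" unfolding mdeg_def by (intro member_le_sum) auto
      then show ?thesis using \<alpha> by (simp add: monoms_def)
    qed (simp add: in_keys_iff)
    then show "restrict (lookup \<alpha>) I \<in> I \<rightarrow>\<^sub>E {..e}" by auto
  qed
  moreover have "finite (I \<rightarrow>\<^sub>E {..e})" using assms by (intro finite_PiE) auto
  ultimately show ?thesis by (meson finite_imageD finite_subset)
qed

lemma monoms_1: "monoms I 1 = (\<lambda>i. Poly_Mapping.single i 1) ` I"
proof (intro equalityI subsetI)
  fix \<alpha> assume "\<alpha> \<in> monoms I 1"
  then have k: "keys \<alpha> \<subseteq> I" and "sum (lookup \<alpha>) (keys \<alpha>) = 1" by (auto simp: monoms_def mdeg_def)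
  then obtain i where i: "i \<in> keys \<alpha>" "lookup \<alpha> i = 1" "\<And>j. j \<in> keys \<alpha> \<Longrightarrow> i \<noteq> j \<Longrightarrow> lookup \<alpha> j = 0"
    by (subst (asm) sum_eq_1_iff) auto
  have "\<alpha> = Poly_Mapping.single i 1"
  proof (rule poly_mapping_eqI)
    fix j show "lookup \<alpha> j = lookup (Poly_Mapping.single i 1) j"
      using i(2) i(3)[of j] by (cases "j \<in> keys \<alpha>") (auto simp: lookup_single when_def in_keys_iff)
  qed
  then show "\<alpha> \<in> (\<lambda>i. Poly_Mapping.single i 1) ` I" using i k by auto
qed (auto simp: monoms_def)

lemma scale_scale: "scale c (scale d f) = scale (c * d) f"
  by (rule poly_mapping_eqI) (simp add: mult_ac)

lemma pclass_scale:
  assumes "c \<noteq> 0"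
  shows "pclass (scale c f) = pclass f"
proof -
  have "\<exists>d. scale e f = scale (d * c) f \<and> d \<noteq> 0" if "e \<noteq> 0" for e
    using assms that by (intro exI[of _ "e / c"]) simp
  then show ?thesis using assms by (auto simp: pclass_def scale_scale)
qed

lemma pclass_eq: "g \<in> pclass f \<Longrightarrow> pclass g = pclass f"
  using pclass_scale[of _ f] by (subst (asm) pclass_def) auto

lemma eval_at_form_pclass_nonzero:
  assumes "F \<in> forms I e" "f \<in> p" "p \<in> proj_forms m d"
  shows "(\<forall>g\<in>p. eval_at (lookup g) F \<noteq> 0) \<longleftrightarrow> eval_at (lookup f) F \<noteq> 0"
proof -
  have p: "p = pclass f" using assms pclass_eq by (auto simp: proj_forms_def)
  show ?thesis unfolding p pclass_def using assms(1) pclass_self[of f]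
    by (auto simp: eval_at_form_scale pclass_def)
qed

lemma proj_forms_rep:
  assumes "p \<in> proj_forms m d" "f \<in> p"
  shows "p = pclass f" "f \<in> forms {..<m} d" "f \<noteq> 0"
proof -
  obtain f0 where f0: "p = pclass f0" "f0 \<in> forms {..<m} d" "f0 \<noteq> 0"
    using assms(1) by (auto simp: proj_forms_def)
  then obtain c where c: "f = scale c f0" "c \<noteq> 0" using assms(2) by (auto simp: pclass_def)
  have keys: "keys f = keys f0" using c by (auto simp: in_keys_iff)
  show "p = pclass f" using f0 assms pclass_eq by auto
  show "f \<in> forms {..<m} d" using f0 keys by (auto simp: forms_def)
  show "f \<noteq> 0" using f0(3) keys by (metis keys_eq_empty)
qed

section \<open>Linear independence by elimination without division\<close>

text \<open>
  Each step clears column \<open>j\<close> from the remaining rows by cross-multiplication instead of division, which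
  makes the definition meaningful over a polynomial ring.  A list of columns shorter than the list of rows gets
  the value \<open>0\<close>.
\<close>

fun pivot_product :: "('j \<Rightarrow> 'a::comm_ring_1) list \<Rightarrow> 'j list \<Rightarrow> 'a" where
  "pivot_product [] js = 1"
| "pivot_product (v # vs) [] = 0"
| "pivot_product (v # vs) (j # js) =
    v j * pivot_product (map (\<lambda>w i. v j * w i - w j * v i) vs) js"

text \<open>
  The rows count as a family, not as a set: a list that repeats a row is dependent.
\<close>

definition rows_independent :: "'j set \<Rightarrow> ('j \<Rightarrow> 'k::field) list \<Rightarrow> bool"
  where "rows_independent J vs \<longleftrightarrow>
    (\<forall>c. (\<forall>j\<in>J. (\<Sum>i<length vs. c i * (vs ! i) j) = 0) \<longrightarrow> (\<forall>i<length vs. c i = 0))"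

text \<open>
  A relation with coefficients \<open>c\<^sub>i\<close> among the reduced rows is the relation among the original
  rows with coefficients \<open>v\<^sub>j c\<^sub>i\<close> and a determined coefficient of \<open>v\<close>.  Conversely, evaluating a
  relation among the original rows in column \<open>j\<close> determines its coefficient of \<open>v\<close>, since
  \<open>v\<^sub>j \<noteq> 0\<close>.
\<close>

lemma rows_independent_Cons:
  assumes "v j \<noteq> 0" "j \<in> J"
  shows "rows_independent J (v # vs) \<longleftrightarrow>
    rows_independent J (map (\<lambda>w i. v j * w i - w j * v i) vs)"
    (is "_ \<longleftrightarrow> rows_independent J ?ws")
proof -
  let ?n = "length vs"
  have reduced: "(\<Sum>i<?n. c i * (?ws ! i) k) =
      v j * (\<Sum>i<?n. c i * (vs ! i) k) - (\<Sum>i<?n. c i * (vs ! i) j) * v k" for c k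
    by (simp add: sum_distrib_left sum_distrib_right sum_subtractf[symmetric] algebra_simps)
  have full: "(\<Sum>i<Suc ?n. c i * ((v # vs) ! i) k) =
      c 0 * v k + (\<Sum>i<?n. c (Suc i) * (vs ! i) k)" for c k
    by (simp add: sum.lessThan_Suc_shift del: sum.lessThan_Suc)
  show ?thesis
  proof
    assume ind: "rows_independent J (v # vs)"
    show "rows_independent J ?ws"
      unfolding rows_independent_def
    proof (intro allI impI)
      fix c i assume c: "\<forall>k\<in>J. (\<Sum>i<length ?ws. c i * (?ws ! i) k) = 0" and i: "i < length ?ws"
      \<comment> \<open>the relation among the original rows that \<open>c\<close> encodes; index \<open>0\<close> belongs to \<open>v\<close>\<close>
      define b where "b i = (case i of 0 \<Rightarrow> - (\<Sum>i<?n. c i * (vs ! i) j) | Suc i \<Rightarrow> v j * c i)" for i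
      have "(\<Sum>i<Suc ?n. b i * ((v # vs) ! i) k) = 0" if "k \<in> J" for k
      proof -
        have "v j * (\<Sum>i<?n. c i * (vs ! i) k) - (\<Sum>i<?n. c i * (vs ! i) j) * v k = 0"
          using c that by (simp only: reduced[symmetric] length_map)
        moreover have "(\<Sum>i<?n. b (Suc i) * (vs ! i) k) = v j * (\<Sum>i<?n. c i * (vs ! i) k)"
          by (simp add: b_def sum_distrib_left mult.assoc)
        ultimately show ?thesis unfolding full by (simp add: b_def)
      qed
      then have "b (Suc i) = 0" using ind i unfolding rows_independent_def by simp
      then show "c i = 0" using assms(1) by (simp add: b_def)
    qed
  next
    assume ind: "rows_independent J ?ws"
    show "rows_independent J (v # vs)"
      unfolding rows_independent_def
    proof (intro allI impI)
      fix c i assume "\<forall>k\<in>J. (\<Sum>i<length (v # vs). c i * ((v # vs) ! i) k) = 0"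
        and i: "i < length (v # vs)"
      then have c: "(\<Sum>i<?n. c (Suc i) * (vs ! i) k) = - (c 0 * v k)" if "k \<in> J" for k
        using that full[of c k] by (simp add: eq_neg_iff_add_eq_0 add.commute)
      have "\<forall>k\<in>J. (\<Sum>i<length ?ws. c (Suc i) * (?ws ! i) k) = 0"
        unfolding length_map reduced[of "\<lambda>i. c (Suc i)"] using c assms(2) by simp
      then have tail: "c (Suc i) = 0" if "i < ?n" for i
        using ind[unfolded rows_independent_def, rule_format, of "\<lambda>i. c (Suc i)"] that by simp
      then have "c 0 * v j = 0" using c[OF assms(2)] by simp
      then show "c i = 0" using tail i assms(1) by (cases i) auto
    qed
  qed
qed

text \<open>
  The first row of an independent family is nonzero in some column, which serves as pivot, and the reduced family is
  again independent; so elimination never gets stuck.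
\<close>

lemma rows_independent_iff_pivot_product:
  "rows_independent J vs \<longleftrightarrow>
    (\<exists>js. set js \<subseteq> J \<and> length js = length vs \<and> pivot_product vs js \<noteq> 0)"
proof (induction "length vs" arbitrary: vs)
  case 0
  then show ?case by (auto simp: rows_independent_def)
next
  case (Suc n)
  then obtain v ws where vs: "vs = v # ws" and n: "n = length ws" by (cases vs) auto
  let ?red = "\<lambda>j. map (\<lambda>w i. v j * w i - w j * v i) ws"
  have IH: "rows_independent J (?red j) \<longleftrightarrow>
    (\<exists>js. set js \<subseteq> J \<and> length js = length ws \<and> pivot_product (?red j) js \<noteq> 0)" for j
    using Suc(1)[of "?red j"] n by simp
  have "\<exists>j\<in>J. v j \<noteq> 0" if "rows_independent J vs"
  proof (rule ccontr)
    assume "\<not> (\<exists>j\<in>J. v j \<noteq> 0)"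
    then have "\<forall>j\<in>J. (\<Sum>i<length vs. (if i = 0 then 1 else 0) * (vs ! i) j) = 0"
      unfolding vs by (simp add: sum.lessThan_Suc_shift del: sum.lessThan_Suc)
    then have "(if (0::nat) = 0 then 1 else 0) = (0::'b)"
      using that[unfolded rows_independent_def, rule_format, of "\<lambda>i. if i = 0 then 1 else 0" 0] vs
      by auto
    then show False by simp
  qed
  then have "rows_independent J vs \<longleftrightarrow> (\<exists>j\<in>J. v j \<noteq> 0 \<and> rows_independent J (?red j))"
    using rows_independent_Cons[of v _ J ws] unfolding vs by blast
  also have "\<dots> \<longleftrightarrow> (\<exists>j js. set (j # js) \<subseteq> J \<and> length (j # js) = length vs \<and>
      pivot_product vs (j # js) \<noteq> 0)"
    unfolding IH vs by auto
  also have "\<dots> \<longleftrightarrow> (\<exists>js. set js \<subseteq> J \<and> length js = length vs \<and> pivot_product vs js \<noteq> 0)"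
  proof
    assume "\<exists>js. set js \<subseteq> J \<and> length js = length vs \<and> pivot_product vs js \<noteq> 0"
    then obtain js where js: "set js \<subseteq> J" "length js = length vs" "pivot_product vs js \<noteq> 0" by blast
    then show "\<exists>j js. set (j # js) \<subseteq> J \<and> length (j # js) = length vs \<and> pivot_product vs (j # js) \<noteq> 0"
      using vs by (cases js) auto
  qed blast
  finally show ?case .
qed

lemma eval_at_pivot_product:
  "eval_at a (pivot_product vs js) = pivot_product (map (\<lambda>v j. eval_at a (v j)) vs) js"
proof (induction vs js rule: pivot_product.induct)
  case (3 v vs j js)
  then show ?case by (simp add: eval_at_mult eval_at_diff comp_def)
qed auto

text \<open>
  The reduced rows are homogeneous of twice the degree of the original ones, hence the
  generalization over \<open>e\<close> in the induction.  Only the existence of the final degree matters for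
  the Zariski topology.
\<close>

lemma pivot_product_in_forms:
  assumes "set js \<subseteq> J" "length js = length vs" "\<And>v j. v \<in> set vs \<Longrightarrow> j \<in> J \<Longrightarrow> v j \<in> forms I e"
  shows "\<exists>e'. pivot_product vs js \<in> forms I e'"
  using assms
proof (induction vs js arbitrary: e rule: pivot_product.induct)
  case (1 js)
  then show ?case using one_in_forms by auto
next
  case (3 v vs j js)
  have "w i \<in> forms I (e + e)" if "w \<in> set (map (\<lambda>w i. v j * w i - w j * v i) vs)" "i \<in> J" for w i
    using that 3(2,4) by (auto intro!: forms_diff forms_mult)
  then obtain e' where "pivot_product (map (\<lambda>w i. v j * w i - w j * v i) vs) js \<in> forms I e'"
    using 3(1)[of "e + e"] 3(2,3) by auto
  moreover have "v j \<in> forms I e" using 3(2,4) by simp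
  ultimately show ?case using forms_mult by fastforce
qed auto

section \<open>The standard locus as a non-vanishing locus\<close>

text \<open>
  Differentiation of monomials is injective on those that contain the variable, so every coefficient
  of the derivative comes from a single coefficient of \<open>f\<close>.
\<close>

lemma lookup_partial:
  "lookup (partial i f) \<gamma> =
    of_nat (lookup \<gamma> i + 1) * lookup f (\<gamma> + Poly_Mapping.single i 1)"
proof -
  let ?e = "Poly_Mapping.single i (1::nat)"
  have "lookup (Poly_Mapping.single (\<beta> - ?e) (of_nat (lookup \<beta> i) * lookup f \<beta>)) \<gamma> =
      (if \<beta> = \<gamma> + ?e then of_nat (lookup \<gamma> i + 1) * lookup f (\<gamma> + ?e) else 0)" for \<beta>
  proof (cases "\<beta> = \<gamma> + ?e")
    case True
    then show ?thesis by (simp add: lookup_add)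
  next
    case False
    show ?thesis
    proof (cases "lookup \<beta> i = 0")
      case nz: False
      have "\<beta> - ?e + ?e = \<beta>"
        using nz by (intro poly_mapping_eqI) (auto simp: lookup_add lookup_minus lookup_single when_def)
      then have "\<beta> - ?e \<noteq> \<gamma>" using False by auto
      then show ?thesis using False by (simp add: lookup_single)
    qed (use False in simp)
  qed
  then show ?thesis
    unfolding partial_def lookup_sum by (auto simp: sum.delta in_keys_iff)
qed

lemma diff_act_linear:
  fixes q f :: "(nat, 'k::comm_ring_1) mpoly"
  assumes "q \<in> forms {..<m} 1"
  shows "lookup (diff_act q f) \<gamma> =
    (\<Sum>i<m. lookup q (Poly_Mapping.single i 1) * lookup (partial i f) \<gamma>)"
proof -
  let ?e = "\<lambda>i::nat. Poly_Mapping.single i (1::nat)"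
  have md: "monom_diff (?e i) f = partial i f" for i and f :: "(nat, 'k) mpoly"
    by (simp add: monom_diff_def)
  have inj: "inj_on ?e {..<m}"
  proof (rule inj_onI)
    fix i j assume "?e i = ?e j"
    then have "keys (?e i) = keys (?e j)" by simp
    then show "i = j" by simp
  qed
  have "lookup (diff_act q f) \<gamma> =
      (\<Sum>\<alpha>\<in>keys q. lookup q \<alpha> * lookup (monom_diff \<alpha> f) \<gamma>)"
    by (simp add: diff_act_def lookup_sum)
  also have "\<dots> = (\<Sum>\<alpha>\<in>?e ` {..<m}. lookup q \<alpha> * lookup (monom_diff \<alpha> f) \<gamma>)"
    using assms unfolding forms_def monoms_1
    by (intro sum.mono_neutral_left) (auto simp: in_keys_iff)
  also have "\<dots> = (\<Sum>i<m. lookup q (?e i) * lookup (partial i f) \<gamma>)"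
    by (subst sum.reindex[OF inj]) (simp only: md o_def)
  finally show ?thesis .
qed

definition gradient :: "nat \<Rightarrow> (nat, 'k::comm_ring_1) mpoly \<Rightarrow> (nat monom \<Rightarrow> 'k) list"
  where "gradient m f = map (\<lambda>i \<gamma>. lookup (partial i f) \<gamma>) [0..<m]"

text \<open>
  The entries of the gradient as linear forms in indeterminate coefficients of \<open>f\<close>, read off
  from \<open>lookup_partial\<close>.
\<close>

definition generic_gradient :: "nat \<Rightarrow> (nat monom \<Rightarrow> (nat monom, 'k::comm_ring_1) mpoly) list"
  where "generic_gradient m = map (\<lambda>i \<gamma>. Poly_Mapping.single
    (Poly_Mapping.single (\<gamma> + Poly_Mapping.single i 1) 1) (of_nat (lookup \<gamma> i + 1))) [0..<m]"

lemma length_gradient [simp]: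
  "length (gradient m f) = m" "length (generic_gradient m) = m"
  by (simp_all add: gradient_def generic_gradient_def)

lemma eval_at_generic_gradient:
  "map (\<lambda>v \<gamma>. eval_at (lookup f) (v \<gamma>)) (generic_gradient m) = gradient m f"
  by (simp add: generic_gradient_def gradient_def lookup_partial comp_def del: of_nat_add of_nat_Suc)

lemma generic_gradient_in_forms:
  assumes "d \<ge> 1" "v \<in> set (generic_gradient m)" "\<gamma> \<in> monoms {..<m} (d - 1)"
  shows "v \<gamma> \<in> forms (monoms {..<m} d) 1"
proof -
  obtain i where i: "i < m" "v \<gamma> = Poly_Mapping.single
      (Poly_Mapping.single (\<gamma> + Poly_Mapping.single i 1) 1) (of_nat (lookup \<gamma> i + 1))"
    using assms(2) by (auto simp: generic_gradient_def)
  have "\<gamma> + Poly_Mapping.single i 1 \<in> monoms {..<m} d"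
    using assms i keys_add[of \<gamma> "Poly_Mapping.single i 1"] by (auto simp: monoms_def mdeg_add)
  then show ?thesis unfolding i(2) by (rule scaled_coord_in_forms)
qed

text \<open>
  A linear operator \<open>q\<close> annihilates \<open>f\<close> iff its coefficients are a linear relation among the
  partial derivatives.  Coefficients outside degree \<open>d - 1\<close> vanish automatically, which leaves
  finitely many columns.
\<close>

lemma standard_iff_gradient_independent:
  assumes "f \<in> forms {..<m} d"
  shows "(\<forall>q\<in>forms {..<m} 1. q \<noteq> 0 \<longrightarrow> diff_act q f \<noteq> 0) \<longleftrightarrow>
    rows_independent (monoms {..<m} (d - 1)) (gradient m f)"
proof -
  let ?e = "\<lambda>i::nat. Poly_Mapping.single i (1::nat)"
  have outside: "lookup (partial i f) \<gamma> = 0" if "\<gamma> \<notin> monoms {..<m} (d - 1)" for i \<gamma>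
  proof -
    have "\<gamma> + ?e i \<notin> monoms {..<m} d"
      using that by (fastforce simp: monoms_def mdeg_add in_keys_iff lookup_add subset_iff)
    then show ?thesis using assms by (auto simp: lookup_partial forms_def in_keys_iff)
  qed
  have zero: "diff_act q f = 0 \<longleftrightarrow>
      (\<forall>\<gamma>\<in>monoms {..<m} (d - 1). (\<Sum>i<m. lookup q (?e i) * lookup (partial i f) \<gamma>) = 0)"
    if "q \<in> forms {..<m} 1" for q
    using outside
    by (metis (no_types, lifting) diff_act_linear[OF that] lookup_zero mult_zero_right
        poly_mapping_eqI sum.neutral)
  have ind: "rows_independent (monoms {..<m} (d - 1)) (gradient m f) \<longleftrightarrow>
    (\<forall>c. (\<forall>\<gamma>\<in>monoms {..<m} (d - 1). (\<Sum>i<m. c i * lookup (partial i f) \<gamma>) = 0) \<longrightarrow> (\<forall>i<m. c i = 0))"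
    by (simp add: rows_independent_def gradient_def)
  show ?thesis
  proof
    assume L: "\<forall>q\<in>forms {..<m} 1. q \<noteq> 0 \<longrightarrow> diff_act q f \<noteq> 0"
    show "rows_independent (monoms {..<m} (d - 1)) (gradient m f)"
      unfolding ind
    proof (intro allI impI)
      fix c i
      assume c: "\<forall>\<gamma>\<in>monoms {..<m} (d - 1). (\<Sum>i<m. c i * lookup (partial i f) \<gamma>) = 0" and i: "i < m"
      define q where "q = (\<Sum>i<m. Poly_Mapping.single (?e i) (c i))"
      have e_eq: "Poly_Mapping.single i (Suc 0) = Poly_Mapping.single j (Suc 0) \<longleftrightarrow> i = j" for i j :: nat
        by (metis keys_single singleton_inject nat.distinct(1))
      have lq: "lookup q (?e i) = c i" if "i < m" for i
        using that by (simp add: q_def lookup_sum lookup_single when_def e_eq sum.delta')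
      have "keys q \<subseteq> (\<Union>i<m. keys (Poly_Mapping.single (?e i) (c i)))"
        unfolding q_def by (rule keys_sum)
      then have q: "q \<in> forms {..<m} 1"
        unfolding forms_def monoms_1 by (auto split: if_splits)
      have "diff_act q f = 0" unfolding zero[OF q] using c by (simp add: lq del: One_nat_def)
      then have "q = 0" using L q by blast
      then show "c i = 0" using lq[OF i] by simp
    qed
  next
    assume R: "rows_independent (monoms {..<m} (d - 1)) (gradient m f)"
    show "\<forall>q\<in>forms {..<m} 1. q \<noteq> 0 \<longrightarrow> diff_act q f \<noteq> 0"
    proof (intro ballI impI notI)
      fix q assume q: "q \<in> forms {..<m} 1" "q \<noteq> 0" "diff_act q f = 0"
      then have "\<forall>i<m. lookup q (?e i) = 0"
        using R[unfolded ind, rule_format, of "\<lambda>i. lookup q (?e i)"] zero[OF q(1)] by auto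
      then have "?e ` {..<m} \<inter> keys q = {}" by (auto simp: in_keys_iff simp del: One_nat_def)
      then have "keys q = {}"
        using q(1) unfolding forms_def monoms_1 by blast
      then show False using q(2) by simp
    qed
  qed
qed

section \<open>Quotients of forms and affine charts\<close>

text \<open>
  In contrast to \<^const>\<open>proj_regular\<close>, a single quotient has to represent the function on all of \<open>X\<close>.
\<close>

definition form_quotient ::
    "nat \<Rightarrow> nat \<Rightarrow> (nat, 'k::field) mpoly set set \<Rightarrow> ((nat, 'k) mpoly set \<Rightarrow> 'k) \<Rightarrow> bool"
  where "form_quotient m d X \<psi> \<longleftrightarrow>
    (\<exists>e. \<exists>F\<in>forms (monoms {..<m} d) e. \<exists>G\<in>forms (monoms {..<m} d) e.
      \<forall>p\<in>X. \<forall>f\<in>p. eval_at (lookup f) G \<noteq> 0 \<and> \<psi> p = eval_at (lookup f) F / eval_at (lookup f) G)"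

lemma form_quotientI:
  assumes "F \<in> forms (monoms {..<m} d) e" "G \<in> forms (monoms {..<m} d) e"
    and "\<And>p f. p \<in> X \<Longrightarrow> f \<in> p \<Longrightarrow> eval_at (lookup f) G \<noteq> 0"
    and "\<And>p f. p \<in> X \<Longrightarrow> f \<in> p \<Longrightarrow> \<psi> p = eval_at (lookup f) F / eval_at (lookup f) G"
  shows "form_quotient m d X \<psi>"
  unfolding form_quotient_def using assms by blast

lemma form_quotient_const: "form_quotient m d X (\<lambda>_. c)"
  by (rule form_quotientI[OF constant_in_forms[of c] one_in_forms]) auto

lemma form_quotient_add:
  assumes "form_quotient m d X \<phi>" "form_quotient m d X \<psi>"
  shows "form_quotient m d X (\<lambda>p. \<phi> p + \<psi> p)"
proof -
  obtain a F G where 1: "F \<in> forms (monoms {..<m} d) a" "G \<in> forms (monoms {..<m} d) a"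
    and v1: "\<And>p f. p \<in> X \<Longrightarrow> f \<in> p \<Longrightarrow>
      eval_at (lookup f) G \<noteq> 0 \<and> \<phi> p = eval_at (lookup f) F / eval_at (lookup f) G"
    using assms(1) unfolding form_quotient_def by blast
  obtain b H K where 2: "H \<in> forms (monoms {..<m} d) b" "K \<in> forms (monoms {..<m} d) b"
    and v2: "\<And>p f. p \<in> X \<Longrightarrow> f \<in> p \<Longrightarrow>
      eval_at (lookup f) K \<noteq> 0 \<and> \<psi> p = eval_at (lookup f) H / eval_at (lookup f) K"
    using assms(2) unfolding form_quotient_def by blast
  have "F * K + G * H \<in> forms (monoms {..<m} d) (a + b)"
    using 1 2 by (intro forms_add forms_mult)
  then show ?thesis
    using forms_mult[OF 1(2) 2(2)]
    by (rule form_quotientI)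
      (use v1 v2 in \<open>auto simp: eval_at_mult eval_at_add add_frac_eq mult.commute\<close>)
qed

lemma form_quotient_mult:
  assumes "form_quotient m d X \<phi>" "form_quotient m d X \<psi>"
  shows "form_quotient m d X (\<lambda>p. \<phi> p * \<psi> p)"
proof -
  obtain a F G where 1: "F \<in> forms (monoms {..<m} d) a" "G \<in> forms (monoms {..<m} d) a"
    and v1: "\<And>p f. p \<in> X \<Longrightarrow> f \<in> p \<Longrightarrow>
      eval_at (lookup f) G \<noteq> 0 \<and> \<phi> p = eval_at (lookup f) F / eval_at (lookup f) G"
    using assms(1) unfolding form_quotient_def by blast
  obtain b H K where 2: "H \<in> forms (monoms {..<m} d) b" "K \<in> forms (monoms {..<m} d) b"
    and v2: "\<And>p f. p \<in> X \<Longrightarrow> f \<in> p \<Longrightarrow>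
      eval_at (lookup f) K \<noteq> 0 \<and> \<psi> p = eval_at (lookup f) H / eval_at (lookup f) K"
    using assms(2) unfolding form_quotient_def by blast
  show ?thesis
    using forms_mult[OF 1(1) 2(1)] forms_mult[OF 1(2) 2(2)]
    by (rule form_quotientI) (use v1 v2 in \<open>auto simp: eval_at_mult\<close>)
qed

text \<open>
  The quotients of forms are a ring containing the constants; hence they are closed under
  substitution into polynomials.  This is where homogenization takes place.
\<close>

lemma form_quotient_eval_at:
  assumes "\<And>i. i \<in> I \<Longrightarrow> form_quotient m d X (\<lambda>p. h p i)" "P \<in> polys I"
  shows "form_quotient m d X (\<lambda>p. eval_at (h p) P)"
proof -
  have pow: "form_quotient m d X (\<lambda>p. h p i ^ k)" if "i \<in> I" for i k
  proof (induction k)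
    case (Suc k)
    then show ?case using form_quotient_mult[OF assms(1)[OF that] Suc] by simp
  qed (simp add: form_quotient_const)
  have prod: "form_quotient m d X (\<lambda>p. \<Prod>i\<in>A. h p i ^ k i)" if "A \<subseteq> I" for A k
    using that
    by (induction A rule: infinite_finite_induct)
      (auto intro: form_quotient_const form_quotient_mult pow)
  have "form_quotient m d X (\<lambda>p. \<Sum>\<alpha>\<in>A. lookup P \<alpha> * monom_eval (h p) \<alpha>)" if "A \<subseteq> keys P" for A
    using that
  proof (induction A rule: infinite_finite_induct)
    case (insert \<alpha> A)
    then show ?case
      using assms(2)
      by (auto simp: polys_def monom_eval_def
        intro!: form_quotient_add form_quotient_mult form_quotient_const prod)
  qed (auto intro: form_quotient_const)
  then show ?thesis by (simp add: eval_at_def)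
qed

text \<open>
  A criterion for a bijection \<open>h\<close> from an open \<open>X\<close> onto an affine closed set to be an isomorphism.  The
  zero set of a polynomial pulls back to the zero set of the numerator of the corresponding quotient of
  forms; the zero set of a form is pushed to that of the polynomial which computes the form on the
  chosen representatives \<open>s\<close>.  The same two translations turn local fractions of one kind into
  local fractions of the other.  One \<open>s\<close> has to serve all forms, since a regular function is locally
  a quotient of two forms evaluated at the same representative.
\<close>

lemma affine_locally_closed_by_coordinates:
  fixes X :: "(nat, 'k::field) mpoly set set"
  assumes X: "openin (proj_zariski m d) X"
    and Y: "closedin (affine_zariski n) Y"
    and bij: "bij_betw h X Y"
    and coords: "\<And>k. k < n \<Longrightarrow> form_quotient m d X (\<lambda>p. h p k)"
    and rep: "\<And>p. p \<in> X \<Longrightarrow> s p \<in> p"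
    and dehom: "\<And>F e. F \<in> forms (monoms {..<m} d) e \<Longrightarrow>
      \<exists>P\<in>polys {..<n}. \<forall>p\<in>X. eval_at (lookup (s p)) F = eval_at (h p) P"
  shows "affine_locally_closed m d X"
proof -
  let ?M = "monoms {..<m} d"
  have X_sub: "X \<subseteq> proj_forms m d" using openin_subset[OF X] by (simp add: topspace_proj_zariski)
  have Y_sub: "Y \<subseteq> affine_space n"
    using closedin_subset[OF Y] by (simp add: topspace_affine_zariski)
  have hY: "h p \<in> Y" if "p \<in> X" for p using bij that by (auto simp: bij_betw_def)
  have tX: "topspace (subtopology (proj_zariski m d) X) = X"
    using X_sub by (auto simp: topspace_proj_zariski)
  have tY: "topspace (subtopology (affine_zariski n) Y) = Y"
    using Y_sub by (auto simp: topspace_affine_zariski)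
  have quot: "form_quotient m d X (\<lambda>p. eval_at (h p) P)" if "P \<in> polys {..<n}" for P
    using coords that by (intro form_quotient_eval_at) auto
  have nz: "(\<exists>f\<in>p. eval_at (lookup f) F \<noteq> 0) \<longleftrightarrow> eval_at (lookup g) F \<noteq> 0"
    if "p \<in> X" "g \<in> p" "F \<in> forms ?M e" for p F e g
    using eval_at_form_pclass_nonzero[OF that(3)] that X_sub by blast
  have pull: "openin (proj_zariski m d) {p\<in>X. h p \<in> U}" if "openin (affine_zariski n) U" for U
  proof -
    obtain S where S: "S \<subseteq> polys {..<n}" "U = affine_space n - affine_zeros n S"
      using \<open>openin (affine_zariski n) U\<close> unfolding openin_affine_zariski by blast
    have "\<exists>F e. F \<in> forms ?M e \<and>
        (\<forall>p\<in>X. \<forall>f\<in>p. eval_at (lookup f) F = 0 \<longleftrightarrow> eval_at (h p) P = 0)" if "P \<in> S" for P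
      using quot[of P] that S(1) unfolding form_quotient_def by fastforce
    then obtain num deg where num: "\<And>P. P \<in> S \<Longrightarrow> num P \<in> forms ?M (deg P)"
      "\<And>P p f. P \<in> S \<Longrightarrow> p \<in> X \<Longrightarrow> f \<in> p \<Longrightarrow>
        eval_at (lookup f) (num P) = 0 \<longleftrightarrow> eval_at (h p) P = 0"
      by metis
    let ?V = "proj_forms m d - proj_zeros m d (num ` S)"
    have "openin (proj_zariski m d) ?V"
      unfolding openin_proj_zariski using num(1) by (intro exI[of _ "num ` S"]) blast
    moreover have "p \<in> ?V \<longleftrightarrow> h p \<in> U" if "p \<in> X" for p
    proof -
      have "p \<in> ?V \<longleftrightarrow> (\<exists>P\<in>S. \<exists>f\<in>p. eval_at (lookup f) (num P) \<noteq> 0)"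
        using that X_sub by (auto simp: proj_zeros_def)
      also have "\<dots> \<longleftrightarrow> (\<exists>P\<in>S. eval_at (h p) P \<noteq> 0)"
        using num(2) that rep[OF that] by blast
      also have "\<dots> \<longleftrightarrow> h p \<in> U"
        using hY[OF that] Y_sub by (auto simp: S(2) affine_zeros_def)
      finally show ?thesis .
    qed
    then have "{p\<in>X. h p \<in> U} = ?V \<inter> X" by blast
    ultimately show ?thesis using X by (simp add: openin_Int)
  qed
  have push: "\<exists>U. openin (affine_zariski n) U \<and> (\<forall>p\<in>X. h p \<in> U \<longleftrightarrow> p \<in> V)"
    if V: "openin (proj_zariski m d) V" for V
  proof -
    obtain S where S: "S \<subseteq> (\<Union>e. forms ?M e)" "V = proj_forms m d - proj_zeros m d S"
      using V unfolding openin_proj_zariski by blast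
    have "\<exists>P e. F \<in> forms ?M e \<and> P \<in> polys {..<n} \<and>
        (\<forall>p\<in>X. eval_at (lookup (s p)) F = eval_at (h p) P)" if "F \<in> S" for F
      using dehom[of F] that S(1) by blast
    then obtain P deg where P: "\<And>F. F \<in> S \<Longrightarrow> F \<in> forms ?M (deg F)"
      "\<And>F. F \<in> S \<Longrightarrow> P F \<in> polys {..<n}"
      "\<And>F p. F \<in> S \<Longrightarrow> p \<in> X \<Longrightarrow> eval_at (lookup (s p)) F = eval_at (h p) (P F)"
      by metis
    let ?U = "affine_space n - affine_zeros n (P ` S)"
    have "openin (affine_zariski n) ?U"
      unfolding openin_affine_zariski using P(2) by (intro exI[of _ "P ` S"]) blast
    moreover have "h p \<in> ?U \<longleftrightarrow> p \<in> V" if p: "p \<in> X" for p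
    proof -
      have "h p \<in> ?U \<longleftrightarrow> (\<exists>F\<in>S. eval_at (lookup (s p)) F \<noteq> 0)"
        using hY[OF p] Y_sub P(3)[OF _ p] by (auto simp: affine_zeros_def)
      also have "\<dots> \<longleftrightarrow> (\<exists>F\<in>S. \<exists>f\<in>p. eval_at (lookup f) F \<noteq> 0)"
        using nz[OF p rep[OF p] P(1)] by blast
      also have "\<dots> \<longleftrightarrow> p \<in> V" using p X_sub by (auto simp: S(2) proj_zeros_def)
      finally show ?thesis .
    qed
    ultimately show ?thesis by blast
  qed
  have homeo: "homeomorphic_map (subtopology (proj_zariski m d) X) (subtopology (affine_zariski n) Y) h"
    unfolding homeomorphic_map_def quotient_map_def tX tY
  proof (intro conjI allI impI)
    show "inj_on h X" "h ` X = Y" using bij by (auto simp: bij_betw_def)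
    fix V assume V: "V \<subseteq> Y"
    show "openin (subtopology (proj_zariski m d) X) {x\<in>X. h x \<in> V} \<longleftrightarrow>
        openin (subtopology (affine_zariski n) Y) V"
    proof
      assume "openin (subtopology (proj_zariski m d) X) {x\<in>X. h x \<in> V}"
      then obtain T where T: "openin (proj_zariski m d) T" "{x\<in>X. h x \<in> V} = T \<inter> X"
        unfolding openin_subtopology by blast
      obtain U where U: "openin (affine_zariski n) U" "\<forall>p\<in>X. h p \<in> U \<longleftrightarrow> p \<in> T"
        using push[OF T(1)] by blast
      have "V = U \<inter> Y"
        using U(2) T(2) V bij unfolding bij_betw_def by blast
      then show "openin (subtopology (affine_zariski n) Y) V"
        using U(1) unfolding openin_subtopology by blast
    next
      assume "openin (subtopology (affine_zariski n) Y) V"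
      then obtain U where U: "openin (affine_zariski n) U" "V = U \<inter> Y"
        unfolding openin_subtopology by blast
      have "{x\<in>X. h x \<in> V} = {x\<in>X. h x \<in> U} \<inter> X" using U hY by blast
      then show "openin (subtopology (proj_zariski m d) X) {x\<in>X. h x \<in> V}"
        using pull[OF U(1)] unfolding openin_subtopology by blast
    qed
  qed
  have regular: "affine_regular n W \<phi> \<longleftrightarrow> proj_regular m d {x\<in>X. h x \<in> W} (\<phi> \<circ> h)"
    if W: "W \<subseteq> Y" for W \<phi>
  proof
    assume R: "affine_regular n W \<phi>"
    show "proj_regular m d {x\<in>X. h x \<in> W} (\<phi> \<circ> h)"
      unfolding proj_regular_def
    proof
      fix p assume p: "p \<in> {x\<in>X. h x \<in> W}"
      then have "h p \<in> W" by simp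
      from R[unfolded affine_regular_def, rule_format, OF this]
      obtain U P Q where U: "openin (affine_zariski n) U" "h p \<in> U"
        and PQ: "P \<in> polys {..<n}" "Q \<in> polys {..<n}"
        and val: "\<forall>b\<in>U \<inter> W. eval_at b Q \<noteq> 0 \<and> \<phi> b = eval_at b P / eval_at b Q"
        by (elim exE conjE bexE)
      obtain a A B where AB: "A \<in> forms ?M a" "B \<in> forms ?M a"
        and vP: "\<And>q f. q \<in> X \<Longrightarrow> f \<in> q \<Longrightarrow> eval_at (lookup f) B \<noteq> 0 \<and>
          eval_at (h q) P = eval_at (lookup f) A / eval_at (lookup f) B"
        using quot[OF PQ(1)] unfolding form_quotient_def by blast
      obtain c C D where CD: "C \<in> forms ?M c" "D \<in> forms ?M c"
        and vQ: "\<And>q f. q \<in> X \<Longrightarrow> f \<in> q \<Longrightarrow> eval_at (lookup f) D \<noteq> 0 \<and>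
          eval_at (h q) Q = eval_at (lookup f) C / eval_at (lookup f) D"
        using quot[OF PQ(2)] unfolding form_quotient_def by blast
      let ?U = "{q\<in>X. h q \<in> U}"
      \<comment> \<open>\<open>(A / B) / (C / D) = A D / (B C)\<close>, with numerator and denominator of degree \<open>a + c\<close>\<close>
      have "eval_at (lookup f) (B * C) \<noteq> 0 \<and>
          (\<phi> \<circ> h) q = eval_at (lookup f) (A * D) / eval_at (lookup f) (B * C)"
        if "q \<in> ?U \<inter> {x\<in>X. h x \<in> W}" "f \<in> q" for q f
      proof -
        have q: "q \<in> X" "h q \<in> U \<inter> W" using that by auto
        show ?thesis using bspec[OF val q(2)] vP[OF q(1) that(2)] vQ[OF q(1) that(2)]
          by (simp add: eval_at_mult)
      qed
      moreover have "A * D \<in> forms ?M (a + c)" "B * C \<in> forms ?M (a + c)"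
        using AB CD by (auto intro: forms_mult)
      ultimately have "\<exists>e. \<exists>F\<in>forms ?M e. \<exists>G\<in>forms ?M e. \<forall>q\<in>?U \<inter> {x\<in>X. h x \<in> W}. \<forall>f\<in>q.
            eval_at (lookup f) G \<noteq> 0 \<and> (\<phi> \<circ> h) q = eval_at (lookup f) F / eval_at (lookup f) G"
        by (intro exI[of _ "a + c"] bexI[of _ "A * D"] bexI[of _ "B * C"] ballI)
      then show "\<exists>U. openin (proj_zariski m d) U \<and> p \<in> U \<and>
          (\<exists>e. \<exists>F\<in>forms ?M e. \<exists>G\<in>forms ?M e. \<forall>q\<in>U \<inter> {x\<in>X. h x \<in> W}. \<forall>f\<in>q.
            eval_at (lookup f) G \<noteq> 0 \<and> (\<phi> \<circ> h) q = eval_at (lookup f) F / eval_at (lookup f) G)"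
        using pull[OF U(1)] U(2) p by (intro exI[of _ ?U] conjI) simp_all
    qed
  next
    assume R: "proj_regular m d {x\<in>X. h x \<in> W} (\<phi> \<circ> h)"
    show "affine_regular n W \<phi>"
      unfolding affine_regular_def
    proof
      fix b assume b: "b \<in> W"
      then obtain p where p: "p \<in> X" "h p = b" using W bij by (auto simp: bij_betw_def)
      then have "p \<in> {x\<in>X. h x \<in> W}" using b by simp
      from R[unfolded proj_regular_def, rule_format, OF this]
      obtain V e F G where V: "openin (proj_zariski m d) V" "p \<in> V"
        and FG: "F \<in> forms ?M e" "G \<in> forms ?M e"
        and val: "\<forall>q\<in>V \<inter> {x\<in>X. h x \<in> W}. \<forall>f\<in>q. eval_at (lookup f) G \<noteq> 0 \<and>
          (\<phi> \<circ> h) q = eval_at (lookup f) F / eval_at (lookup f) G"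
        by (elim exE conjE bexE)
      obtain U where U: "openin (affine_zariski n) U" "\<forall>p\<in>X. h p \<in> U \<longleftrightarrow> p \<in> V"
        using push[OF V(1)] by blast
      obtain P where P: "P \<in> polys {..<n}" "\<forall>p\<in>X. eval_at (lookup (s p)) F = eval_at (h p) P"
        using dehom[OF FG(1)] by blast
      obtain Q where Q: "Q \<in> polys {..<n}" "\<forall>p\<in>X. eval_at (lookup (s p)) G = eval_at (h p) Q"
        using dehom[OF FG(2)] by blast
      have "eval_at c Q \<noteq> 0 \<and> \<phi> c = eval_at c P / eval_at c Q" if c: "c \<in> U \<inter> W" for c
      proof -
        obtain q where q: "q \<in> X" "h q = c" using c W bij by (auto simp: bij_betw_def)
        then have "q \<in> V" using U(2) c by blast
        then have "q \<in> V \<inter> {x\<in>X. h x \<in> W}" using q c by simp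
        from bspec[OF bspec[OF val this] rep[OF q(1)]] show ?thesis using P(2) Q(2) q by simp
      qed
      then have "\<exists>F\<in>polys {..<n}. \<exists>G\<in>polys {..<n}. \<forall>b\<in>U \<inter> W.
          eval_at b G \<noteq> 0 \<and> \<phi> b = eval_at b F / eval_at b G"
        using P(1) Q(1) by (intro bexI[of _ P] bexI[of _ Q] ballI)
      then show "\<exists>U. openin (affine_zariski n) U \<and> b \<in> U \<and>
          (\<exists>F\<in>polys {..<n}. \<exists>G\<in>polys {..<n}. \<forall>b\<in>U \<inter> W.
            eval_at b G \<noteq> 0 \<and> \<phi> b = eval_at b F / eval_at b G)"
        using U V(2) p by (intro exI[of _ U] conjI) auto
    qed
  qed
  have "locally_closedin (proj_zariski m d) X"
    unfolding locally_closedin_def using X openin_subset[OF X]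
    by (intro exI[of _ X] exI[of _ "topspace (proj_zariski m d)"]) auto
  moreover have "regular_isomorphism (subtopology (proj_zariski m d) X) (proj_regular m d)
      (subtopology (affine_zariski n) Y) (affine_regular n) h"
    unfolding regular_isomorphism_def tX
    using homeo regular openin_subset[of "subtopology (affine_zariski n) Y"] tY by auto
  ultimately show ?thesis unfolding affine_locally_closed_def using Y by blast
qed

definition chart_piece ::
    "nat \<Rightarrow> nat \<Rightarrow> nat monom \<Rightarrow> (nat monom, 'k::field) mpoly \<Rightarrow> (nat, 'k) mpoly set set"
  where "chart_piece m d \<alpha> F =
    {p \<in> proj_forms m d. \<forall>f\<in>p. lookup f \<alpha> \<noteq> 0 \<and> eval_at (lookup f) F \<noteq> 0}"

definition normalized :: "nat monom \<Rightarrow> (nat, 'k::field) mpoly set \<Rightarrow> (nat, 'k) mpoly"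
  where "normalized \<alpha> p = (SOME f. f \<in> p \<and> lookup f \<alpha> = 1)"

lemma normalized_pclass:
  assumes "lookup f \<alpha> \<noteq> 0"
  shows "normalized \<alpha> (pclass f) = scale (inverse (lookup f \<alpha>)) f"
  unfolding normalized_def
proof (rule some_equality)
  show "scale (inverse (lookup f \<alpha>)) f \<in> pclass f \<and>
      lookup (scale (inverse (lookup f \<alpha>)) f) \<alpha> = 1"
    using assms by (auto simp: pclass_def)
next
  fix g assume "g \<in> pclass f \<and> lookup g \<alpha> = 1"
  then obtain c where "g = scale c f" "c * lookup f \<alpha> = 1" by (auto simp: pclass_def)
  then show "g = scale (inverse (lookup f \<alpha>)) f"
    by (metis inverse_unique mult.commute)
qed

text \<open>
  The coordinates are indexed by an enumeration \<open>g\<close> of the \<open>N\<close> monomials of degree \<open>d\<close>, followed by the extra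
  coordinate \<open>N\<close> for the inverse of \<open>F\<close> (the Rabinowitsch trick).  They are the quotients
  \<open>f\<^sub>\<beta> / f\<^sub>\<alpha>\<close> and \<open>f\<^sub>\<alpha>\<^sup>e / F(f)\<close>, both of degree \<open>0\<close>.
\<close>

lemma affine_chart_piece:
  fixes F :: "(nat monom, 'k::field) mpoly"
  assumes \<alpha>: "\<alpha> \<in> monoms {..<m} d" and F: "F \<in> forms (monoms {..<m} d) e"
  shows "affine_locally_closed m d (chart_piece m d \<alpha> F)"
proof -
  let ?M = "monoms {..<m} d"
  let ?X = "chart_piece m d \<alpha> F"
  define N where "N = card ?M"
  obtain g where g: "bij_betw g {..<N} ?M"
    using ex_bij_betw_nat_finite[OF finite_monoms[of "{..<m}" d]]
    by (auto simp: N_def atLeast0LessThan)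
  define g' where "g' = inv_into {..<N} g"
  have g': "g' \<beta> < N" "g (g' \<beta>) = \<beta>" if "\<beta> \<in> ?M" for \<beta>
    using g that inv_into_into[of \<beta> g "{..<N}"] f_inv_into_f[of \<beta> g "{..<N}"]
    unfolding g'_def bij_betw_def by auto
  have gM: "g k \<in> ?M" "g' (g k) = k" if "k < N" for k
    using g that by (auto simp: g'_def bij_betw_def)
  have coordinate: "coord \<beta> \<in> forms ?M 1" if "\<beta> \<in> ?M" for \<beta> :: "nat monom"
    using that by (rule scaled_coord_in_forms)
  have polys: "\<exists>P\<in>polys {..<Suc N}. \<forall>a. eval_at a P = eval_at (a \<circ> g') H"
    if "H \<in> forms ?M e" for e and H :: "(nat monom, 'k) mpoly"
  proof -
    have "H \<in> polys ?M" using that forms_subset_polys by blast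
    then obtain P where P: "P \<in> polys (g' ` ?M)" "\<And>a. eval_at a P = eval_at (a \<circ> g') H"
      by (rule rename_variables[where g = g']) blast
    have "g' ` ?M \<subseteq> {..<Suc N}" using g'(1) by fastforce
    then have "P \<in> polys {..<Suc N}" using P(1) unfolding polys_def by blast
    then show ?thesis using P(2) by (intro bexI[of _ P] allI)
  qed
  obtain F' where F': "F' \<in> polys {..<Suc N}" "\<And>a. eval_at a F' = eval_at (a \<circ> g') F"
    using polys[OF F] by blast
  define s :: "(nat, 'k) mpoly set \<Rightarrow> _" where "s = normalized \<alpha>"
  have s_eq: "s p = scale (inverse (lookup f \<alpha>)) f" if "p \<in> ?X" "f \<in> p" for p f
    using that normalized_pclass[of f \<alpha>] proj_forms_rep(1)[of p m d f]
    by (auto simp: s_def chart_piece_def)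
  have s: "s p \<in> p" "lookup (s p) \<alpha> = 1" "s p \<in> forms {..<m} d" "p = pclass (s p)"
    "eval_at (lookup (s p)) F \<noteq> 0" if p: "p \<in> ?X" for p
  proof -
    obtain f where f: "p = pclass f" using p by (auto simp: chart_piece_def proj_forms_def)
    have fp: "f \<in> p" using f pclass_self by blast
    have nz: "lookup f \<alpha> \<noteq> 0" using p fp by (auto simp: chart_piece_def)
    have sp: "s p = scale (inverse (lookup f \<alpha>)) f" by (rule s_eq[OF p fp])
    show mem: "s p \<in> p" unfolding sp using nz by (auto simp: f pclass_def)
    show "lookup (s p) \<alpha> = 1" unfolding sp using nz by simp
    show "s p \<in> forms {..<m} d" "p = pclass (s p)" "eval_at (lookup (s p)) F \<noteq> 0"
      using proj_forms_rep[OF _ mem, of m d] mem p by (auto simp: chart_piece_def)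
  qed
  define h where "h p = (\<lambda>k\<in>{..<Suc N}.
    if k < N then lookup (s p) (g k) else inverse (eval_at (lookup (s p)) F))" for p
  have h_g': "h p (g' \<beta>) = lookup (s p) \<beta>" if "\<beta> \<in> ?M" for p \<beta>
    using g'[OF that] by (simp add: h_def)
  have eval_h: "eval_at (h p \<circ> g') H = eval_at (lookup (s p)) H" if "H \<in> forms ?M e" for p H e
    using that forms_subset_polys by (intro eval_at_cong[of H ?M]) (auto simp: h_g')
  \<comment> \<open>the equations \<open>a\<^sub>\<alpha> = 1\<close> and \<open>t F(a) = 1\<close>\<close>
  define S where "S = {coord (g' \<alpha>) - 1, coord N * F' - (1 :: (nat, 'k) mpoly)}"
  define Y where "Y = affine_zeros (Suc N) S"
  have Y_iff: "a \<in> Y \<longleftrightarrow> a \<in> affine_space (Suc N) \<and> a (g' \<alpha>) = 1 \<and> a N * eval_at (a \<circ> g') F = 1" for a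
    by (simp add: Y_def S_def affine_zeros_def eval_at_diff eval_at_mult F'(2))
  have "S \<subseteq> polys {..<Suc N}"
    unfolding S_def using F'(1) g'(1)[OF \<alpha>]
    by (auto simp del: One_nat_def intro!: polys_diff polys_mult coord_in_polys one_in_polys)
  then have closed: "closedin (affine_zariski (Suc N)) Y"
    unfolding closedin_affine_zariski Y_def by blast
  have CF: "coord \<alpha> * F \<in> forms ?M (1 + e)" by (intro forms_mult coordinate \<alpha> F)
  have "?X = proj_forms m d - proj_zeros m d {coord \<alpha> * F}"
    \<comment> \<open>for a form, vanishing at one representative and at all of them are the same\<close>
  proof -
    have "(\<forall>f\<in>p. lookup f \<alpha> \<noteq> 0 \<and> eval_at (lookup f) F \<noteq> 0) \<longleftrightarrow>
        \<not> (\<forall>f\<in>p. eval_at (lookup f) (coord \<alpha> * F) = 0)" if p: "p \<in> proj_forms m d" for p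
      using eval_at_form_pclass_nonzero[OF CF _ p] pclass_self p
      unfolding proj_forms_def by (fastforce simp: eval_at_mult)
    then show ?thesis by (auto simp: chart_piece_def proj_zeros_def)
  qed
  then have "openin (proj_zariski m d) ?X"
    unfolding openin_proj_zariski using CF by (intro exI[of _ "{coord \<alpha> * F}"]) auto
  moreover have "bij_betw h ?X Y"
  proof (rule bij_betw_imageI)
    show "inj_on h ?X"
    proof (rule inj_onI)
      fix p q assume p: "p \<in> ?X" and q: "q \<in> ?X" and eq: "h p = h q"
      have "lookup (s p) \<beta> = lookup (s q) \<beta>" for \<beta>
      proof (cases "\<beta> \<in> ?M")
        case True
        then show ?thesis using h_g'[of \<beta>] eq by metis
      next
        case False
        then have "\<beta> \<notin> keys (s p)" "\<beta> \<notin> keys (s q)" using s(3)[OF p] s(3)[OF q] by (auto simp: forms_def)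
        then show ?thesis by (simp add: in_keys_iff)
      qed
      then have "s p = s q" by (rule poly_mapping_eqI)
      then show "p = q" using s(4)[OF p] s(4)[OF q] by simp
    qed
    have "h p \<in> Y" if p: "p \<in> ?X" for p
      unfolding Y_iff using s[OF p] eval_h[OF F, of p] h_g'[OF \<alpha>, of p]
      by (auto simp: affine_space_def h_def)
    moreover have "\<exists>p\<in>?X. h p = a" if a: "a \<in> Y" for a
    proof
      define f where "f = (\<Sum>\<beta>\<in>?M. Poly_Mapping.single \<beta> (a (g' \<beta>)))"
      have lf: "lookup f \<beta> = (if \<beta> \<in> ?M then a (g' \<beta>) else 0)" for \<beta>
        by (simp add: f_def lookup_sum lookup_single when_def sum.delta finite_monoms)
      have ff: "f \<in> forms {..<m} d" by (auto simp: forms_def in_keys_iff lf split: if_splits)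
      have f1: "lookup f \<alpha> = 1" using a \<alpha> by (simp add: lf Y_iff)
      then have f0: "f \<noteq> 0" by auto
      have evf: "eval_at (lookup f) F = eval_at (a \<circ> g') F"
        using F forms_subset_polys by (intro eval_at_cong[of F ?M]) (auto simp: lf)
      then have Ff: "a N * eval_at (lookup f) F = 1" using a by (simp add: Y_iff)
      then have Fnz: "eval_at (lookup f) F \<noteq> 0" by auto
      have pf: "pclass f \<in> proj_forms m d" using ff f0 by (auto simp: proj_forms_def)
      have "lookup g \<alpha> \<noteq> 0" if "g \<in> pclass f" for g using that f1 by (auto simp: pclass_def)
      then show X: "pclass f \<in> ?X"
        using pf eval_at_form_pclass_nonzero[OF F pclass_self pf] Fnz by (auto simp: chart_piece_def)
      have "s (pclass f) = f"
        using s_eq[OF X pclass_self] f1 by (intro poly_mapping_eqI) simp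
      moreover have "inverse (eval_at (lookup f) F) = a N"
        using Ff by (metis inverse_unique mult.commute)
      ultimately have "h (pclass f) k = a k" if "k < Suc N" for k
        using that gM[of k] by (cases "k = N") (simp_all add: h_def lf)
      moreover have "h (pclass f) \<in> affine_space (Suc N)" "a \<in> affine_space (Suc N)"
        using a by (simp_all add: h_def affine_space_def Y_iff)
      ultimately show "h (pclass f) = a"
        unfolding affine_space_def by (intro PiE_ext) auto
    qed
    ultimately show "h ` ?X = Y" by blast
  qed
  moreover have "form_quotient m d ?X (\<lambda>p. h p k)" if k: "k < Suc N" for k
  proof (cases "k < N")
    case True
    have "h p k = lookup f (g k) / lookup f \<alpha>" if "p \<in> ?X" "f \<in> p" for p f
      using True s_eq[OF that] by (simp add: h_def field_simps)
    then show ?thesis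
      using coordinate[OF gM(1)[OF True]] coordinate[OF \<alpha>]
      by (intro form_quotientI[of "coord (g k)" _ _ 1 "coord \<alpha>"]) (auto simp: chart_piece_def)
  next
    case False
    have "h p k = lookup f \<alpha> ^ e / eval_at (lookup f) F" if "p \<in> ?X" "f \<in> p" for p f
      using False k s_eq[OF that] eval_at_form_scale[OF F]
      by (simp add: h_def field_simps)
    moreover have "coord \<alpha> ^ e' \<in> forms ?M e'" for e'
    proof (induction e')
      case (Suc e')
      then show ?case using forms_mult[OF coordinate[OF \<alpha>] Suc] by simp
    qed (simp add: one_in_forms)
    moreover have "eval_at a (coord \<alpha> ^ e') = a \<alpha> ^ e'" for a :: "_ \<Rightarrow> 'k" and e'
      by (induction e') (auto simp: eval_at_mult)
    ultimately show ?thesis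
      using F by (intro form_quotientI[of "coord \<alpha> ^ e" _ _ e F]) (auto simp: chart_piece_def)
  qed
  moreover have "\<exists>P\<in>polys {..<Suc N}. \<forall>p\<in>?X. eval_at (lookup (s p)) H = eval_at (h p) P"
    if "H \<in> forms ?M e'" for H e'
    using polys[OF that] eval_h[OF that] by metis
  ultimately show ?thesis
    using closed s(1) by (intro affine_locally_closed_by_coordinates[of m d ?X "Suc N" Y h s]) auto
qed

theorem lemma2p5:
  fixes m d :: nat
  assumes "m \<ge> 2" and "d \<ge> 1"
  shows "\<exists>\<A> :: (nat, 'k::{alg_closed_field, field_char_0}) mpoly set set set.
    finite \<A> \<and> (\<forall>X\<in>\<A>. affine_locally_closed m d X) \<and> standard_locus m d = \<Union>\<A>"
proof -
  let ?M = "monoms {..<m} d"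
  let ?J = "monoms {..<m} (d - 1)"
  define Js where "Js = {js. set js \<subseteq> ?J \<and> length js = m}"
  define E :: "nat monom list \<Rightarrow> (nat monom, 'k) mpoly"
    where "E js = pivot_product (generic_gradient m) js" for js
  define \<A> where "\<A> = (\<lambda>(\<alpha>, js). chart_piece m d \<alpha> (E js)) ` (?M \<times> Js)"
  have "finite Js" unfolding Js_def by (intro finite_lists_length_eq finite_monoms) simp
  then have "finite \<A>" unfolding \<A>_def by (intro finite_imageI finite_SigmaI finite_monoms) auto
  moreover have form: "\<exists>e. E js \<in> forms ?M e" if "js \<in> Js" for js
    unfolding E_def
    by (rule pivot_product_in_forms[of js ?J _ _ 1])
      (use that generic_gradient_in_forms[OF assms(2), of _ m] in \<open>auto simp: Js_def\<close>)
  then have "\<forall>X\<in>\<A>. affine_locally_closed m d X"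
    using affine_chart_piece unfolding \<A>_def by fast
  moreover have "standard_locus m d = \<Union>\<A>"
  proof -
    have crit: "(\<forall>q\<in>forms {..<m} 1. q \<noteq> 0 \<longrightarrow> diff_act q f \<noteq> 0) \<longleftrightarrow>
        (\<exists>js\<in>Js. eval_at (lookup f) (E js) \<noteq> 0)" if "f \<in> forms {..<m} d" for f
      unfolding standard_iff_gradient_independent[OF that] rows_independent_iff_pivot_product
      by (auto simp: E_def Js_def eval_at_pivot_product eval_at_generic_gradient)
    show ?thesis
    proof (intro equalityI subsetI)
      fix p :: "(nat, 'k) mpoly set" assume "p \<in> standard_locus m d"
      then obtain f where f: "p = pclass f" "f \<in> forms {..<m} d" "f \<noteq> 0"
        "\<forall>q\<in>forms {..<m} 1. q \<noteq> 0 \<longrightarrow> diff_act q f \<noteq> 0"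
        by (auto simp: standard_locus_def)
      then obtain js where js: "js \<in> Js" "eval_at (lookup f) (E js) \<noteq> 0"
        using crit[OF f(2)] by blast
      obtain \<alpha> where \<alpha>: "\<alpha> \<in> keys f" using f(3) by (metis equals0I keys_eq_empty)
      then have \<alpha>M: "\<alpha> \<in> ?M" using f(2) by (auto simp: forms_def)
      have p: "p \<in> proj_forms m d" "f \<in> p" using f pclass_self by (auto simp: proj_forms_def)
      have "\<forall>g\<in>p. lookup g \<alpha> \<noteq> 0" using \<alpha> by (auto simp: f(1) pclass_def in_keys_iff)
      moreover have "\<forall>g\<in>p. eval_at (lookup g) (E js) \<noteq> 0"
        using form[OF js(1)] eval_at_form_pclass_nonzero[OF _ p(2,1)] js(2) by blast
      ultimately have "p \<in> chart_piece m d \<alpha> (E js)" using p(1) by (simp add: chart_piece_def)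
      then show "p \<in> \<Union>\<A>" unfolding \<A>_def using \<alpha>M js(1) by auto
    next
      fix p assume "p \<in> \<Union>\<A>"
      then obtain \<alpha> js where p: "p \<in> proj_forms m d" and js: "js \<in> Js"
        and nz: "\<forall>f\<in>p. eval_at (lookup f) (E js) \<noteq> 0"
        by (auto simp: \<A>_def chart_piece_def)
      obtain f where f: "p = pclass f" "f \<in> forms {..<m} d" "f \<noteq> 0"
        using p by (auto simp: proj_forms_def)
      then have "\<forall>q\<in>forms {..<m} 1. q \<noteq> 0 \<longrightarrow> diff_act q f \<noteq> 0"
        using crit[OF f(2)] js nz pclass_self by blast
      then show "p \<in> standard_locus m d" unfolding standard_locus_def using f by blast
    qed
  qed
  ultimately show ?thesis by blast
qed

end
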